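(* Let $n, N \geq 2$ be integers with $N$ odd, and let $s$ be the multiplicative order of $2$ modulo $N$. Assume $2^n \equiv 1 \pmod s$ (so $s$ is odd). Let $l$ be the largest integer such that $2^l < s$, let $b$ be the integer with $0 \leq b < s$ and $2^{l+1} \equiv b \pmod s$, and let $a$ be the multiplicative order of $2$ modulo $s$. Set $$k_l = 1 + \sum_{j=0}^{l} 2^{2^j}, \qquad k_b = \sum_{j=0}^{a-1} 2^{b\cdot 2^j},$$ and assume that $\gcd(k_b, N) \mid k_l$. Then there are infinitely many integers $m$ such that $$F_n + F_{n+1} + \cdots + F_{n+m} \equiv m \pmod N,$$ where $F_{t} = 2^{2^{t}} + 1$ denotes the $t$-th Fermat number.
   Context: The multiplicative order of $2$ modulo an odd integer $M$ (called in the paper the exponent to which $2$ belongs modulo $M$) is the least positive integer $x$ with $2^x \equiv 1 \pmod M$. The integers $m$ are nonnegative, so that the sum is $\sum_{j=0}^{m} F_{n+j}$. *)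

theory Defs
  imports "HOL-Number_Theory.Number_Theory"
begin

definition fermat_number :: "nat \<Rightarrow> nat" where
  "fermat_number t = 2 ^ (2 ^ t) + 1"

end

theory Submission
  imports Defs
begin

text \<open>
  Modulo \<open>N\<close> a power of \<open>2\<close> depends only on its exponent modulo \<open>s\<close>, the order of \<open>2\<close>.  Since
  \<open>2 ^ n\<close> is \<open>1\<close> modulo \<open>s\<close>, the shift by \<open>n\<close> disappears: the sum of Fermat numbers is congruent
  to \<open>m\<close> plus \<open>1 + (\<Sum>j\<le>m. 2 ^ 2 ^ j)\<close>, so the latter has to vanish modulo \<open>N\<close> for infinitely
  many \<open>m\<close>.

  Let \<open>m = l + a * t\<close>.  The terms with \<open>j \<le> l\<close> and the summand \<open>1\<close> give \<open>k_l\<close>.  The exponents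
  \<open>2 ^ (l + 1 + j)\<close> of the others are \<open>b * 2 ^ j\<close> modulo \<open>s\<close>, and these repeat with period \<open>a\<close>, the
  order of \<open>2\<close> modulo \<open>s\<close>.  By lemma \<open>sum_periodic_cong\<close> the remaining terms therefore
  contribute \<open>t * k_b\<close>.  What is left is the linear congruence \<open>k_l + t * k_b = 0\<close> modulo \<open>N\<close>,
  whose solvability is the hypothesis on the gcd; one solution \<open>t\<close> yields its whole residue class
  (lemma \<open>infinite_linear_cong_solutions\<close>), and \<open>a > 0\<close> carries their infinitude over to \<open>m\<close>.
\<close>

lemma sum_periodic_cong:
  fixes g :: "nat \<Rightarrow> nat"
  assumes "\<And>j. [g (j + p) = g j] (mod N)"
  shows "[(\<Sum>j<p * t. g j) = t * (\<Sum>j<p. g j)] (mod N)"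
proof (induction t)
  case 0
  show ?case by simp
next
  case (Suc t)
  have shift: "[g (j + p * t) = g j] (mod N)" for j
  proof (induction t)
    case (Suc t)
    have "[g (j + p * t + p) = g (j + p * t)] (mod N)"
      by (rule assms)
    with Suc show ?case
      by (auto simp: algebra_simps intro: cong_trans)
  qed simp
  have "(\<Sum>j<p * Suc t. g j) = (\<Sum>j<p * t. g j) + (\<Sum>j<p. g (j + p * t))"
    using sum.nat_group[of g p "Suc t"] sum.nat_group[of g p t]
      sum.shift_bounds_nat_ivl[of g 0 "p * t" p]
    by (simp add: atLeast0LessThan algebra_simps)
  also have "[\<dots> = t * (\<Sum>j<p. g j) + (\<Sum>j<p. g j)] (mod N)"
    by (intro cong_add Suc.IH cong_sum shift)
  finally show ?case by (simp add: algebra_simps)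
qed

lemma infinite_linear_cong_solutions:
  fixes c d N :: nat
  assumes "N > 0" and "gcd d N dvd c"
  shows "infinite {t. [c + t * d = 0] (mod N)}"
proof -
  obtain x where x: "[d * x = gcd d N] (mod N)"
    using cong_solve_nat[of d N] by blast
  obtain q where q: "c = gcd d N * q"
    using assms(2) by (rule dvdE)
  \<comment> \<open>The factor \<open>N - 1\<close> represents \<open>-1\<close> modulo \<open>N\<close> in the natural numbers.\<close>
  define t0 where "t0 = x * q * (N - 1)"
  have "[t0 * d = gcd d N * (q * (N - 1))] (mod N)"
    using cong_scalar_right[OF x, of "q * (N - 1)"] by (simp add: t0_def ac_simps)
  then have "[c + t0 * d = c + c * (N - 1)] (mod N)"
    unfolding q mult.assoc by (rule cong_add[OF cong_refl])
  also have "c + c * (N - 1) = c * N"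
    using assms(1) by (cases N) simp_all
  finally have "[c + t0 * d = 0] (mod N)"
    by (simp add: cong_def)
  then have sol: "[c + (t0 + N * i) * d = 0] (mod N)" for i
    by (simp add: cong_def algebra_simps flip: add.assoc)
  have "inj (\<lambda>i. t0 + N * i)"
    using assms(1) by (auto intro: injI)
  then have "infinite (range (\<lambda>i. t0 + N * i))"
    by (rule range_inj_infinite)
  then show ?thesis
    by (rule infinite_super[rotated]) (use sol in auto)
qed

theorem corollary2:
  fixes n N s l b a k_l k_b :: nat
  assumes "n \<ge> 2" and "N \<ge> 2" and "odd N"
    and "s = ord N 2"
    and "[2 ^ n = 1] (mod s)"
    and "2 ^ l < s" and "\<And>i::nat. 2 ^ i < s \<Longrightarrow> i \<le> l"
    and "b < s" and "[2 ^ (l + 1) = b] (mod s)"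
    and "a = ord s 2"
    and "k_l = 1 + (\<Sum>j=0..l. 2 ^ (2 ^ j))"
    and "k_b = (\<Sum>j<a. 2 ^ (b * 2 ^ j))"
    and "gcd k_b N dvd k_l"
  shows "infinite {m::nat. [(\<Sum>j=0..m. fermat_number (n + j)) = m] (mod N)}"
proof -
  have pow_cong: "[(2::nat) ^ d = 2 ^ e] (mod N)" if "[d = e] (mod s)" for d e
    using that order_divides_expdiff[of N 2 d e] \<open>odd N\<close> \<open>s = ord N 2\<close>
    by (simp add: coprime_commute)
  have "coprime (2 ^ n) s"
    using cong_imp_coprime[OF cong_sym[OF assms(5)]] by simp
  then have "coprime s 2"
    using \<open>n \<ge> 2\<close> by (simp add: coprime_commute)
  then have "a > 0" and a: "[2 ^ a = 1] (mod s)"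
    using \<open>a = ord s 2\<close> ord[of 2 s] by (auto simp: ord_eq_0)

  have sum_eq: "[(\<Sum>j=0..m. fermat_number (n + j)) = m + (1 + (\<Sum>j=0..m. 2 ^ 2 ^ j))] (mod N)" for m
  proof -
    have "(\<Sum>j=0..m. fermat_number (n + j)) = (\<Sum>j=0..m. 2 ^ 2 ^ (n + j)) + (m + 1)"
      unfolding fermat_number_def sum.distrib by simp
    also have "[\<dots> = (\<Sum>j=0..m. 2 ^ 2 ^ j) + (m + 1)] (mod N)"
    proof (intro cong_add cong_sum pow_cong)
      fix j show "[2 ^ (n + j) = 2 ^ j] (mod s)"
        using cong_scalar_right[OF assms(5), of "2 ^ j"] by (simp add: power_add)
    qed simp_all
    finally show ?thesis by (simp add: ac_simps)
  qed

  have block: "[1 + (\<Sum>j=0..l + a * t. 2 ^ 2 ^ j) = k_l + t * k_b] (mod N)" for t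
  proof -
    have "(\<Sum>j=0..l + a * t. (2::nat) ^ 2 ^ j)
        = (\<Sum>j=0..l. 2 ^ 2 ^ j) + (\<Sum>j<a * t. 2 ^ 2 ^ (l + 1 + j))"
      using sum.atLeastLessThan_concat[of 0 "l + 1" "l + 1 + a * t" "\<lambda>j. (2::nat) ^ 2 ^ j"]
        sum.shift_bounds_nat_ivl[of "\<lambda>j. (2::nat) ^ 2 ^ j" 0 "l + 1" "a * t"]
      by (simp add: atLeast0LessThan atLeast0AtMost lessThan_Suc_atMost ac_simps del: power_Suc)
    then have "1 + (\<Sum>j=0..l + a * t. 2 ^ 2 ^ j) = k_l + (\<Sum>j<a * t. 2 ^ 2 ^ (l + 1 + j))"
      by (simp add: assms(11))
    also have "[\<dots> = k_l + (\<Sum>j<a * t. 2 ^ (b * 2 ^ j))] (mod N)"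
    proof (intro cong_add cong_sum pow_cong)
      fix j show "[2 ^ (l + 1 + j) = b * 2 ^ j] (mod s)"
        using cong_scalar_right[OF assms(9), of "2 ^ j"] by (simp only: power_add)
    qed simp
    also have "[k_l + (\<Sum>j<a * t. 2 ^ (b * 2 ^ j)) = k_l + t * k_b] (mod N)"
      unfolding assms(12)
    proof (intro cong_add sum_periodic_cong pow_cong)
      fix j show "[b * 2 ^ (j + a) = b * 2 ^ j] (mod s)"
        using cong_scalar_left[OF a, of "b * 2 ^ j"] by (simp add: power_add ac_simps)
    qed simp
    finally show ?thesis .
  qed

  have "[(\<Sum>j=0..l + a * t. fermat_number (n + j)) = l + a * t] (mod N)"
    if "[k_l + t * k_b = 0] (mod N)" for t
  proof -
    have "[1 + (\<Sum>j=0..l + a * t. 2 ^ 2 ^ j) = 0] (mod N)"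
      using block that by (rule cong_trans)
    then have "[l + a * t + (1 + (\<Sum>j=0..l + a * t. 2 ^ 2 ^ j)) = l + a * t + 0] (mod N)"
      by (intro cong_add cong_refl)
    with sum_eq show ?thesis
      by (metis add_0_right cong_trans)
  qed
  then have sub: "(\<lambda>t. l + a * t) ` {t. [k_l + t * k_b = 0] (mod N)}
      \<subseteq> {m. [(\<Sum>j=0..m. fermat_number (n + j)) = m] (mod N)}"
    by blast
  have "infinite {t. [k_l + t * k_b = 0] (mod N)}"
    using \<open>N \<ge> 2\<close> assms(13) by (intro infinite_linear_cong_solutions) simp_all
  moreover have "inj_on (\<lambda>t. l + a * t) {t. [k_l + t * k_b = 0] (mod N)}"
    using \<open>a > 0\<close> by (auto intro: inj_onI)
  ultimately have "infinite ((\<lambda>t. l + a * t) ` {t. [k_l + t * k_b = 0] (mod N)})"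
    by (simp add: finite_image_iff)
  with sub show ?thesis
    by (rule infinite_super)
qed

end
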